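(* Let $R$ be a Bézout domain and let $n\in\{2,3\}$. Every matrix $T\in\mathbb{M}_n(R)$ with $T^2=0_n$ has stable range one in the ring $\mathbb{M}_n(R)$.
   Context: An integral domain is a GCD domain if every pair $a,b$ of nonzero elements has a greatest common divisor $\gcd(a,b)$; it is a Bézout domain if moreover $\gcd(a,b)$ is a linear combination of $a$ and $b$. $\mathbb{M}_n(R)$ is the ring of $n\times n$ matrices over $R$ and $0_n$ is its zero element. An element $a$ of a unital ring $S$ has (left) stable range one if for every $b\in S$ with $Sa+Sb=S$ there exists $y\in S$ such that $a+yb$ is a unit of $S$. *)

theory Defs
  imports "Jordan_Normal_Form.Matrix"
begin

context comm_monoid_mult
begin

definition is_gcd :: "'a \<Rightarrow> 'a \<Rightarrow> 'a \<Rightarrow> bool" where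
  "is_gcd d a b \<longleftrightarrow> d dvd a \<and> d dvd b \<and> (\<forall>e. e dvd a \<and> e dvd b \<longrightarrow> e dvd d)"

end

(* Not the library class semiring_gcd, which fixes a gcd operation with normalized values. *)
class gcd_domain = idom +
  assumes ex_is_gcd: "a \<noteq> 0 \<Longrightarrow> b \<noteq> 0 \<Longrightarrow> \<exists>d. is_gcd d a b"

class bezout_domain = gcd_domain +
  assumes is_gcd_linear_combination:
    "a \<noteq> 0 \<Longrightarrow> b \<noteq> 0 \<Longrightarrow> is_gcd d a b \<Longrightarrow> \<exists>x y. d = x * a + y * b"

definition left_stable_range_one :: "('a, 'b) ring_scheme \<Rightarrow> 'a \<Rightarrow> bool" where
  "left_stable_range_one S a \<longleftrightarrow>
     a \<in> carrier S \<and>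
     (\<forall>b \<in> carrier S.
        {s \<otimes>\<^bsub>S\<^esub> a \<oplus>\<^bsub>S\<^esub> t \<otimes>\<^bsub>S\<^esub> b | s t. s \<in> carrier S \<and> t \<in> carrier S} = carrier S \<longrightarrow>
        (\<exists>y \<in> carrier S. a \<oplus>\<^bsub>S\<^esub> y \<otimes>\<^bsub>S\<^esub> b \<in> Units S))"

end

(* Suppose that for every s there is a unit x with a x a = a s a. Then a has stable range one:
   if s a + t b = 1, then a + x^-1 t b = x^-1 (1 + (x - s) a), and (x - s) a squares to zero.
   The property is invariant under a |-> p a q with units p and q. It holds for r E_00 in size
   n >= 2 over any commutative ring, because a matrix in GL_n can have any prescribed
   (0,0) entry. Over a Bezout domain every matrix whose 2x2 minors all vanish is equivalent
   to some r E_00, and T^2 = 0 forces the minors to vanish for n = 2, 3; for n = 3 this is read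
   off after a conjugation that makes the first row of T zero. *)

theory Submission imports Defs begin

section \<open>Unit interpolation and stable range one in an arbitrary ring\<close>

definition unit_interpolated :: "('a, 'b) ring_scheme \<Rightarrow> 'a \<Rightarrow> bool" where
  "unit_interpolated S a \<longleftrightarrow> (\<forall>s \<in> carrier S. \<exists>x \<in> Units S.
     a \<otimes>\<^bsub>S\<^esub> x \<otimes>\<^bsub>S\<^esub> a = a \<otimes>\<^bsub>S\<^esub> s \<otimes>\<^bsub>S\<^esub> a)"

lemma (in ring) one_plus_square_zero_Units:
  assumes w: "w \<in> carrier R" and ww: "w \<otimes> w = \<zero>"
  shows "\<one> \<oplus> w \<in> Units R"
proof -
  have "(\<one> \<oplus> w) \<otimes> (\<one> \<ominus> w) = \<one>" "(\<one> \<ominus> w) \<otimes> (\<one> \<oplus> w) = \<one>"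
    using w ww by (simp_all add: minus_eq l_distr r_distr l_minus r_minus a_assoc l_neg r_neg)
  then show ?thesis
    using w unfolding Units_def by (auto intro!: bexI[of _ "\<one> \<ominus> w"])
qed

lemma (in ring) left_stable_range_one_if_unit_interpolated:
  assumes a: "a \<in> carrier R" and ui: "unit_interpolated R a"
  shows "left_stable_range_one R a"
  unfolding left_stable_range_one_def
proof (intro conjI ballI impI)
  fix b assume b: "b \<in> carrier R"
    and gen: "{s \<otimes> a \<oplus> t \<otimes> b | s t. s \<in> carrier R \<and> t \<in> carrier R} = carrier R"
  have "\<one> \<in> {s \<otimes> a \<oplus> t \<otimes> b | s t. s \<in> carrier R \<and> t \<in> carrier R}"
    using gen by simp
  then obtain s t where s: "s \<in> carrier R" and t: "t \<in> carrier R"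
    and one: "\<one> = s \<otimes> a \<oplus> t \<otimes> b" by blast
  obtain x where xU: "x \<in> Units R" and x: "a \<otimes> x \<otimes> a = a \<otimes> s \<otimes> a"
    using ui s unfolding unit_interpolated_def by blast
  have xc [simp]: "x \<in> carrier R" "inv x \<in> carrier R" using xU by auto
  note [simp] = a b s t
  \<comment> \<open>This is the error made on replacing \<open>s\<close> by \<open>x\<close> in the
    relation for \<open>\<one>\<close>, so that \<open>1 + w = x a + t b\<close>. The choice of
    \<open>x\<close> gives \<open>a w = a x a - a s a = 0\<close>, whence
    \<open>w w = (x - s) (a w) = 0\<close>.\<close>
  define w where "w = (x \<ominus> s) \<otimes> a"
  have w: "w \<in> carrier R" by (simp add: w_def)
  have "a \<otimes> w = a \<otimes> x \<otimes> a \<ominus> a \<otimes> s \<otimes> a"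
    by (simp add: w_def minus_eq l_distr r_distr l_minus r_minus m_assoc)
  then have aw: "a \<otimes> w = \<zero>" by (simp add: x r_neg minus_eq)
  have "w \<otimes> w = (x \<ominus> s) \<otimes> (a \<otimes> w)" using w by (subst (1) w_def) (simp add: m_assoc)
  then have "w \<otimes> w = \<zero>" by (simp add: aw)
  then have U: "inv x \<otimes> (\<one> \<oplus> w) \<in> Units R"
    using one_plus_square_zero_Units[OF w] xU by simp
  have "\<one> \<oplus> w = (s \<otimes> a \<oplus> \<ominus> (s \<otimes> a)) \<oplus> (x \<otimes> a \<oplus> t \<otimes> b)"
    unfolding one w_def by (simp add: minus_eq l_distr l_minus a_ac)
  then have "\<one> \<oplus> w = x \<otimes> a \<oplus> t \<otimes> b" by (simp add: r_neg)
  then have "inv x \<otimes> (\<one> \<oplus> w) = inv x \<otimes> x \<otimes> a \<oplus> inv x \<otimes> t \<otimes> b"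
    by (simp add: r_distr m_assoc)
  then have "a \<oplus> inv x \<otimes> t \<otimes> b \<in> Units R" using U xU by simp
  then show "\<exists>y \<in> carrier R. a \<oplus> y \<otimes> b \<in> Units R"
    by (intro bexI[of _ "inv x \<otimes> t"]) auto
qed (rule a)

text \<open>Carries the property from a normal form \<open>p a q\<close> back to \<open>a\<close>. A
  unit \<open>x\<close> that works for the normal form becomes the unit \<open>q x p\<close> for
  \<open>a\<close>.\<close>

lemma (in ring) unit_interpolated_if_equivalent:
  assumes a: "a \<in> carrier R" and p: "p \<in> Units R" and q: "q \<in> Units R"
    and ui: "unit_interpolated R (p \<otimes> a \<otimes> q)"
  shows "unit_interpolated R a"
  unfolding unit_interpolated_def
proof
  fix s assume s: "s \<in> carrier R"
  have [simp]: "p \<in> carrier R" "q \<in> carrier R" "inv p \<in> carrier R" "inv q \<in> carrier R"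
    using p q by auto
  note [simp] = a s
  \<comment> \<open>With this argument the inner copies of \<open>q\<close> and \<open>p\<close>
    cancel, and the right-hand side becomes \<open>p (a s a) q\<close>.\<close>
  have "inv q \<otimes> s \<otimes> inv p \<in> carrier R" by simp
  then obtain x where xU: "x \<in> Units R"
    and x: "(p \<otimes> a \<otimes> q) \<otimes> x \<otimes> (p \<otimes> a \<otimes> q) =
      (p \<otimes> a \<otimes> q) \<otimes> (inv q \<otimes> s \<otimes> inv p) \<otimes> (p \<otimes> a \<otimes> q)"
    using ui unfolding unit_interpolated_def by blast
  have [simp]: "x \<in> carrier R" using xU by auto
  have qi: "q \<otimes> (inv q \<otimes> z) = z" and pi: "inv p \<otimes> (p \<otimes> z) = z"
    if "z \<in> carrier R" for z
    using that p q by (simp_all flip: m_assoc)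
  have "p \<otimes> (a \<otimes> (q \<otimes> x \<otimes> p) \<otimes> a) \<otimes> q = p \<otimes> (a \<otimes> s \<otimes> a) \<otimes> q"
    using x by (simp add: m_assoc qi pi)
  then have "inv p \<otimes> (p \<otimes> (a \<otimes> (q \<otimes> x \<otimes> p) \<otimes> a) \<otimes> q) \<otimes> inv q =
      inv p \<otimes> (p \<otimes> (a \<otimes> s \<otimes> a) \<otimes> q) \<otimes> inv q" by simp
  then have "a \<otimes> (q \<otimes> x \<otimes> p) \<otimes> a = a \<otimes> s \<otimes> a"
    using p q by (simp add: m_assoc pi)
  then show "\<exists>x\<in>Units R. a \<otimes> x \<otimes> a = a \<otimes> s \<otimes> a"
    using p q xU by (intro bexI[of _ "q \<otimes> x \<otimes> p"]) auto
qed

section \<open>Matrices acting as a 2x2 block \<open>(a b; c d)\<close> on coordinates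
  \<open>p\<close>, \<open>q\<close> and as the identity on the others\<close>

definition plane_mat :: "nat \<Rightarrow> nat \<Rightarrow> nat \<Rightarrow> 'a \<Rightarrow> 'a \<Rightarrow> 'a \<Rightarrow> 'a \<Rightarrow> 'a :: comm_ring_1 mat" where
  "plane_mat n p q a b c d = mat n n (\<lambda>(i, j).
     if i = p then if j = p then a else if j = q then b else 0
     else if i = q then if j = p then c else if j = q then d else 0
     else if i = j then 1 else 0)"

lemma plane_mat_carrier [simp]: "plane_mat n p q a b c d \<in> carrier_mat n n"
  by (simp add: plane_mat_def)

lemma index_plane_mat_mult_vec:
  assumes "p < n" "q < n" "p \<noteq> q" "w \<in> carrier_vec n" "i < n"
  shows "(plane_mat n p q a b c d *\<^sub>v w) $ i =
    (if i = p then a * w $ p + b * w $ q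
     else if i = q then c * w $ p + d * w $ q else w $ i)"
proof -
  have two: "(\<Sum>j = 0..<n. (if j = p then x else if j = q then y else 0) * w $ j) =
      x * w $ p + y * w $ q" for x y
  proof -
    have "(\<Sum>j = 0..<n. (if j = p then x else if j = q then y else 0) * w $ j) =
        (\<Sum>j \<in> {p, q}. (if j = p then x else if j = q then y else 0) * w $ j)"
      using assms by (intro sum.mono_neutral_right) auto
    then show ?thesis using assms by simp
  qed
  have one: "(\<Sum>j = 0..<n. (if i = j then 1 else 0) * w $ j) = w $ i"
    using assms by (simp add: if_distrib[of "\<lambda>x. x * _"] cong: if_cong)
  show ?thesis
    using assms two one by (auto simp: plane_mat_def scalar_prod_def row_def)
qed

text \<open>The second factor carries the adjugate of the block, which is its inverse when the
  determinant is 1.\<close>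

lemma plane_mat_mult_inverse:
  assumes "p < n" "q < n" "p \<noteq> q" "a * d - b * c = 1"
  shows "plane_mat n p q a b c d * plane_mat n p q d (- b) (- c) a = 1\<^sub>m n"
    (is "?A * ?B = _")
proof (rule eq_matI)
  fix i j assume "i < dim_row (1\<^sub>m n :: 'a mat)" "j < dim_col (1\<^sub>m n :: 'a mat)"
  then have ij: "i < n" "j < n" by auto
  have "(?A * ?B) $$ (i, j) = (?A *\<^sub>v col ?B j) $ i"
    using ij by (simp add: plane_mat_def)
  also have "\<dots> = 1\<^sub>m n $$ (i, j)"
    using ij assms
    by (subst index_plane_mat_mult_vec) (auto simp: plane_mat_def col_def algebra_simps)
  finally show "(?A * ?B) $$ (i, j) = 1\<^sub>m n $$ (i, j)" .
qed (auto simp: plane_mat_def)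

lemma plane_mat_Units:
  assumes "p < n" "q < n" "p \<noteq> q" "a * d - b * c = 1"
  shows "plane_mat n p q a b c d \<in> Units (ring_mat TYPE('a :: comm_ring_1) n e)"
proof -
  have "plane_mat n p q a b c d * plane_mat n p q d (- b) (- c) a = 1\<^sub>m n"
    by (rule plane_mat_mult_inverse[OF assms])
  moreover have "plane_mat n p q d (- b) (- c) a * plane_mat n p q a b c d = 1\<^sub>m n"
    \<comment> \<open>The adjugate block also has determinant 1, and its adjugate is the original
      block, so the same lemma gives the product in the other order.\<close>
    using plane_mat_mult_inverse[of p n q d a "- b" "- c"] assms by (simp add: mult.commute)
  ultimately show ?thesis
    unfolding Units_def ring_mat_simps
    by (intro CollectI conjI bexI[of _ "plane_mat n p q d (- b) (- c) a"]) simp_all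
qed

lemma index_mult_mat_sum:
  assumes "A \<in> carrier_mat n n" "B \<in> carrier_mat n n" "i < n" "j < n"
  shows "(A * B) $$ (i, j) = (\<Sum>k = 0..<n. A $$ (i, k) * B $$ (k, j))"
  using assms by (simp add: scalar_prod_def)

text \<open>Between two copies of \<open>A\<close>, a matrix contributes only its (0,0) entry. It
  therefore suffices to find an invertible matrix with a prescribed entry there.\<close>

lemma unit_interpolated_single_entry:
  fixes A :: "'a :: comm_ring_1 mat"
  assumes n: "2 \<le> n" and A: "A \<in> carrier_mat n n"
    and off: "\<And>i j. i < n \<Longrightarrow> j < n \<Longrightarrow> i \<noteq> 0 \<or> j \<noteq> 0 \<Longrightarrow> A $$ (i, j) = 0"
  shows "unit_interpolated (ring_mat TYPE('a) n e) A"
proof -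
  have sandwich: "A * M * A = mat n n (\<lambda>(i, j). A $$ (i, 0) * M $$ (0, 0) * A $$ (0, j))"
    if M: "M \<in> carrier_mat n n" for M
  proof (rule eq_matI)
    fix i j assume "i < dim_row (mat n n (\<lambda>(i, j). A $$ (i, 0) * M $$ (0, 0) * A $$ (0, j)))"
      "j < dim_col (mat n n (\<lambda>(i, j). A $$ (i, 0) * M $$ (0, 0) * A $$ (0, j)))"
    then have ij: "i < n" "j < n" by auto
    have AM: "(A * M) $$ (i, k) = A $$ (i, 0) * M $$ (0, k)" if "k < n" for k
    proof -
      have "(A * M) $$ (i, k) = (\<Sum>l = 0..<n. A $$ (i, l) * M $$ (l, k))"
        using A M ij that by (intro index_mult_mat_sum)
      also have "\<dots> = (\<Sum>l \<in> {0}. A $$ (i, l) * M $$ (l, k))"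
        using n ij off by (intro sum.mono_neutral_right) auto
      finally show ?thesis by simp
    qed
    have "(A * M * A) $$ (i, j) = (\<Sum>k = 0..<n. (A * M) $$ (i, k) * A $$ (k, j))"
      using A M ij by (intro index_mult_mat_sum) auto
    also have "\<dots> = (\<Sum>k \<in> {0}. (A * M) $$ (i, k) * A $$ (k, j))"
      using n ij off by (intro sum.mono_neutral_right) auto
    finally show "(A * M * A) $$ (i, j) =
        mat n n (\<lambda>(i, j). A $$ (i, 0) * M $$ (0, 0) * A $$ (0, j)) $$ (i, j)"
      using ij n AM by simp
  qed (use A M in auto)
  show ?thesis
    unfolding unit_interpolated_def
  proof
    fix s assume "s \<in> carrier (ring_mat TYPE('a) n e)"
    then have s: "s \<in> carrier_mat n n" by (simp add: ring_mat_simps)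
    \<comment> \<open>The block \<open>(s00 1; -1 0)\<close> has determinant 1 whatever
      \<open>s00\<close> is. It occupies coordinates 0 and 1, which is where
      \<open>2 \<le> n\<close> enters.\<close>
    let ?x = "plane_mat n 0 1 (s $$ (0, 0)) 1 (- 1) 0"
    have "?x \<in> Units (ring_mat TYPE('a) n e)"
      using n by (intro plane_mat_Units) auto
    moreover have "A * ?x * A = A * s * A"
      using n s by (simp add: sandwich) (simp add: plane_mat_def)
    ultimately show "\<exists>x \<in> Units (ring_mat TYPE('a) n e).
        A \<otimes>\<^bsub>ring_mat TYPE('a) n e\<^esub> x \<otimes>\<^bsub>ring_mat TYPE('a) n e\<^esub> A =
        A \<otimes>\<^bsub>ring_mat TYPE('a) n e\<^esub> s \<otimes>\<^bsub>ring_mat TYPE('a) n e\<^esub> A"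
      by (auto simp: ring_mat_simps)
  qed
qed

section \<open>Reduction of rows, columns and rank-one matrices over a Bezout domain\<close>

lemma bezout_clear_entry:
  fixes x y :: "'a :: bezout_domain"
  shows "\<exists>a b c d. a * d - b * c = 1 \<and> c * x + d * y = 0"
proof (cases "x = 0 \<or> y = 0")
  case True
  then show ?thesis
  proof
    assume "x = 0"
    \<comment> \<open>A signed swap moves the possibly nonzero \<open>y\<close> to the first
      coordinate; the identity would leave it in the second.\<close>
    then show ?thesis by (intro exI[of _ 0] exI[of _ "- 1"] exI[of _ 1] exI[of _ 0]) simp
  next
    assume "y = 0"
    then show ?thesis by (intro exI[of _ 1] exI[of _ 0] exI[of _ 0] exI[of _ 1]) simp
  qed
next
  case False
  then obtain g where g: "is_gcd g x y" using ex_is_gcd by blast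
  with False obtain k l where kl: "g = k * x + l * y"
    using is_gcd_linear_combination by blast
  from g obtain x' y' where xy: "x = g * x'" "y = g * y'"
    unfolding is_gcd_def dvd_def by blast
  \<comment> \<open>Cancelling \<open>g\<close> turns the Bezout relation into
    \<open>k x' + l y' = 1\<close>. This is the determinant of the block with rows
    \<open>(k, l)\<close> and \<open>(-y', x')\<close>, and the second row annihilates
    \<open>(x, y)\<close>.\<close>
  have "g * 1 = g * (k * x' + l * y')"
    using kl xy by (simp add: algebra_simps)
  moreover have "g \<noteq> 0" using False xy by auto
  ultimately have "k * x' + l * y' = 1" by (metis mult_left_cancel)
  then show ?thesis
    by (intro exI[of _ k] exI[of _ l] exI[of _ "- y'"] exI[of _ x'])
      (simp add: xy algebra_simps)
qed

lemma Units_ring_mat_carrier: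
  "P \<in> Units (ring_mat TYPE('a :: semiring_1) n e) \<Longrightarrow> P \<in> carrier_mat n n"
  by (simp add: Units_def ring_mat_simps)

lemma Units_ring_mat_mult:
  fixes P Q :: "'a :: comm_ring_1 mat"
  assumes "P \<in> Units (ring_mat TYPE('a) n e)" "Q \<in> Units (ring_mat TYPE('a) n e)"
  shows "P * Q \<in> Units (ring_mat TYPE('a) n e)"
proof -
  interpret ring "ring_mat TYPE('a) n e" by (rule ring_mat)
  show ?thesis using Units_m_closed[OF assms] by (simp add: ring_mat_simps)
qed

text \<open>The entries below the top are cleared one after another, each by a determinant-one block
  that mixes it with entry 0.\<close>

lemma bezout_column_reduction:
  fixes v :: "'a :: bezout_domain vec"
  assumes n: "0 < n" and v: "v \<in> carrier_vec n"
  shows "\<exists>P \<in> Units (ring_mat TYPE('a) n e). \<forall>j < n. j \<noteq> 0 \<longrightarrow> (P *\<^sub>v v) $ j = 0"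
proof -
  let ?U = "Units (ring_mat TYPE('a) n e)"
  interpret ring "ring_mat TYPE('a) n e" by (rule ring_mat)
  \<comment> \<open>The induction is on the length \<open>k\<close> of the prefix already cleared;
    index 0 is exempt because it collects the surviving entry.\<close>
  have "\<exists>P \<in> ?U. \<forall>j < k. j \<noteq> 0 \<longrightarrow> (P *\<^sub>v v) $ j = 0" if "k \<le> n" for k
    using that
  proof (induction k)
    case 0
    have "1\<^sub>m n \<in> ?U" using Units_one_closed by (simp add: ring_mat_simps)
    then show ?case by auto
  next
    case (Suc k)
    then obtain P where P: "P \<in> ?U" and Pv: "\<forall>j < k. j \<noteq> 0 \<longrightarrow> (P *\<^sub>v v) $ j = 0"
      by auto
    have Pc: "P \<in> carrier_mat n n" using P by (rule Units_ring_mat_carrier)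
    show ?case
    proof (cases "k = 0")
      case True
      then show ?thesis using P by auto
    next
      case False
      obtain a b c d where det: "a * d - b * c = 1"
        and clear: "c * (P *\<^sub>v v) $ 0 + d * (P *\<^sub>v v) $ k = 0"
        using bezout_clear_entry by blast
      let ?G = "plane_mat n 0 k a b c d"
      have "?G * P \<in> ?U"
        using Suc.prems False det P by (intro Units_ring_mat_mult plane_mat_Units) auto
      moreover have "(?G * P *\<^sub>v v) $ j = 0" if "j < Suc k" "j \<noteq> 0" for j
      proof -
        have "(?G * P *\<^sub>v v) $ j = (?G *\<^sub>v (P *\<^sub>v v)) $ j"
          using Pc v by (simp add: assoc_mult_mat_vec[of _ n n])
        \<comment> \<open>The new factor changes coordinates 0 and \<open>k\<close> only, so the
          zeros obtained earlier survive.\<close>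
        also have "\<dots> = 0"
          using that Suc.prems False clear Pv Pc v
          by (subst index_plane_mat_mult_vec) (auto simp: mult_mat_vec_carrier)
        finally show ?thesis .
      qed
      ultimately show ?thesis by blast
    qed
  qed
  then show ?thesis by blast
qed

lemma transpose_Units_ring_mat:
  fixes P :: "'a :: comm_ring_1 mat"
  assumes "P \<in> Units (ring_mat TYPE('a) n e)"
  shows "transpose_mat P \<in> Units (ring_mat TYPE('a) n e)"
proof -
  from assms obtain P' where P: "P \<in> carrier_mat n n" and P': "P' \<in> carrier_mat n n"
    and inv: "P' * P = 1\<^sub>m n" "P * P' = 1\<^sub>m n"
    by (auto simp: Units_def ring_mat_simps)
  have "transpose_mat P' * transpose_mat P = 1\<^sub>m n" "transpose_mat P * transpose_mat P' = 1\<^sub>m n"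
    using transpose_mult[OF P P', symmetric] transpose_mult[OF P' P, symmetric]
    by (simp_all add: inv)
  then show ?thesis
    using P P' unfolding Units_def
    by (auto simp: ring_mat_simps intro!: bexI[of _ "transpose_mat P'"])
qed

text \<open>This is the transpose of the column reduction. The scalar products are the entries of
  the row \<open>v\<close> times \<open>Q\<close>, in the form in which they occur in a matrix
  product.\<close>

lemma bezout_row_reduction:
  fixes v :: "'a :: bezout_domain vec"
  assumes n: "0 < n" and v: "v \<in> carrier_vec n"
  shows "\<exists>Q \<in> Units (ring_mat TYPE('a) n e). \<forall>j < n. j \<noteq> 0 \<longrightarrow> v \<bullet> col Q j = 0"
proof -
  obtain P where P: "P \<in> Units (ring_mat TYPE('a) n e)"
    and Pv: "\<forall>j < n. j \<noteq> 0 \<longrightarrow> (P *\<^sub>v v) $ j = 0"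
    using bezout_column_reduction[OF assms, of e] by blast
  have Pc: "P \<in> carrier_mat n n" using P by (rule Units_ring_mat_carrier)
  have "v \<bullet> col (transpose_mat P) j = (P *\<^sub>v v) $ j" if "j < n" for j
    using that Pc v by (simp add: comm_scalar_prod[of v n])
  then show ?thesis
    using transpose_Units_ring_mat[OF P] Pv by (intro bexI[of _ "transpose_mat P"]) simp_all
qed

text \<open>Vanishing minors make all rows proportional, over the fraction field, to any nonzero
  row. Column operations that reduce one such row to its first entry thus clear all columns but the
  first, and row operations then reduce that column.\<close>

lemma unit_interpolated_if_minors_zero:
  fixes T :: "'a :: bezout_domain mat"
  assumes n: "2 \<le> n" and T: "T \<in> carrier_mat n n"
    and minors: "\<And>i j k l. i < n \<Longrightarrow> j < n \<Longrightarrow> k < n \<Longrightarrow> l < n \<Longrightarrow>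
      T $$ (i, j) * T $$ (k, l) = T $$ (i, l) * T $$ (k, j)"
  shows "unit_interpolated (ring_mat TYPE('a) n e) T"
proof -
  let ?S = "ring_mat TYPE('a) n e"
  interpret ring ?S by (rule ring_mat)
  have "\<exists>Q \<in> Units ?S. \<forall>k < n. \<forall>l < n. l \<noteq> 0 \<longrightarrow> (T * Q) $$ (k, l) = 0"
  proof (cases "\<exists>i < n. \<exists>j < n. T $$ (i, j) \<noteq> 0")
    case False
    have "1\<^sub>m n \<in> Units ?S" using Units_one_closed by (simp add: ring_mat_simps)
    then show ?thesis using False T by (intro bexI[of _ "1\<^sub>m n"]) auto
  next
    case True
    then obtain i j where ij: "i < n" "j < n" and nz: "T $$ (i, j) \<noteq> 0" by blast
    obtain Q where Q: "Q \<in> Units ?S" and Qi: "\<forall>l < n. l \<noteq> 0 \<longrightarrow> row T i \<bullet> col Q l = 0"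
      using bezout_row_reduction[of n "row T i" e] n row_carrier_vec[OF ij(1) T] by auto
    have Qc: "Q \<in> carrier_mat n n" using Q by (rule Units_ring_mat_carrier)
    have "(T * Q) $$ (k, l) = 0" if kl: "k < n" "l < n" "l \<noteq> 0" for k l
    proof -
      \<comment> \<open>Multiplying by the nonzero pivot lets the minor identity trade row
        \<open>k\<close> for row \<open>i\<close>, which \<open>Q\<close> has cleared; the pivot is
        cancelled at the end.\<close>
      have "T $$ (i, j) * (T * Q) $$ (k, l) = (\<Sum>m = 0..<n. T $$ (i, j) * T $$ (k, m) * Q $$ (m, l))"
        using T Qc kl by (simp add: scalar_prod_def sum_distrib_left mult.assoc)
      also have "\<dots> = (\<Sum>m = 0..<n. T $$ (k, j) * (T $$ (i, m) * Q $$ (m, l)))"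
        using ij kl by (intro sum.cong) (auto simp: minors[of i j k] mult_ac)
      also have "\<dots> = T $$ (k, j) * (row T i \<bullet> col Q l)"
        using T Qc kl ij by (simp add: scalar_prod_def sum_distrib_left)
      also have "\<dots> = 0" using Qi kl by simp
      finally show ?thesis using nz by simp
    qed
    then show ?thesis using Q by blast
  qed
  then obtain Q where Q: "Q \<in> Units ?S"
    and TQ: "\<forall>k < n. \<forall>l < n. l \<noteq> 0 \<longrightarrow> (T * Q) $$ (k, l) = 0" by blast
  have Qc: "Q \<in> carrier_mat n n" using Q by (rule Units_ring_mat_carrier)
  have TQc: "T * Q \<in> carrier_mat n n" using T Qc by simp
  obtain P where P: "P \<in> Units ?S"
    and PTQ: "\<forall>k < n. k \<noteq> 0 \<longrightarrow> (P *\<^sub>v col (T * Q) 0) $ k = 0"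
    using bezout_column_reduction[of n "col (T * Q) 0" e] n col_carrier_vec[OF _ TQc, of 0] by auto
  have Pc: "P \<in> carrier_mat n n" using P by (rule Units_ring_mat_carrier)
  \<comment> \<open>Left multiplication by \<open>P\<close> keeps the zero columns of
    \<open>T * Q\<close> zero, so the two reductions do not interfere.\<close>
  have "(P * (T * Q)) $$ (k, l) = 0" if kl: "k < n" "l < n" "k \<noteq> 0 \<or> l \<noteq> 0" for k l
  proof (cases "l = 0")
    case True
    then show ?thesis using kl PTQ Pc TQc by auto
  next
    case False
    then show ?thesis
      using kl TQ by (simp add: index_mult_mat_sum[OF Pc TQc])
  qed
  then have "unit_interpolated ?S (P * (T * Q))"
    using n Pc TQc by (intro unit_interpolated_single_entry) auto
  then have "unit_interpolated ?S (P \<otimes>\<^bsub>?S\<^esub> T \<otimes>\<^bsub>?S\<^esub> Q)"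
    using Pc T Qc by (simp add: ring_mat_simps)
  then show ?thesis
    using P Q T
    by (intro unit_interpolated_if_equivalent[of T P Q]) (simp_all add: ring_mat_simps)
qed

section \<open>Vanishing minors of square-zero matrices of size two and three\<close>

lemma square_zero_minors:
  fixes a b c d x y :: "'a :: idom"
  assumes "a * a + b * c = 0" "b * (a + d) = 0" "c * (a + d) = 0" "d * d + b * c = 0"
    and "a * x + b * y = 0" "c * x + d * y = 0"
  shows "a * d = b * c" "x * c = a * y" "x * d = b * y"
proof -
  \<comment> \<open>The block \<open>B = (a b; c d)\<close> satisfies \<open>B B = 0\<close> and
    kills the column \<open>(x, y)\<close>. If its trace were nonzero, \<open>b\<close> and
    \<open>c\<close> would vanish, then \<open>a\<close> and \<open>d\<close> as their squares do,
    and the trace would be zero after all. With trace zero, the three identities are rewritings of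
    the hypotheses.\<close>
  have tr: "d = - a"
  proof (rule ccontr)
    assume "d \<noteq> - a"
    then have "a + d \<noteq> 0" by (metis add_eq_0_iff)
    with assms have "b = 0" "c = 0" by auto
    with assms have "a = 0" "d = 0" by auto
    with \<open>d \<noteq> - a\<close> show False by simp
  qed
  show "a * d = b * c" "x * c = a * y" "x * d = b * y"
    using assms by (simp_all add: tr algebra_simps eq_neg_iff_add_eq_0 neg_eq_iff_add_eq_0)
qed

lemma index_mult_mat_2:
  assumes "A \<in> carrier_mat 2 2" "B \<in> carrier_mat 2 2" "i < 2" "j < 2"
  shows "(A * B) $$ (i, j) = A $$ (i, 0) * B $$ (0, j) + A $$ (i, 1) * B $$ (1, j)"
  using assms by (subst index_mult_mat_sum[of _ 2]) (auto simp: numeral_2_eq_2)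

lemma index_mult_mat_3:
  assumes "A \<in> carrier_mat 3 3" "B \<in> carrier_mat 3 3" "i < 3" "j < 3"
  shows "(A * B) $$ (i, j) = A $$ (i, 0) * B $$ (0, j) + A $$ (i, 1) * B $$ (1, j)
    + A $$ (i, 2) * B $$ (2, j)"
  using assms by (subst index_mult_mat_sum[of _ 3]) (auto simp: numeral_3_eq_3 numeral_2_eq_2)

lemma unit_interpolated_square_zero_2:
  fixes T :: "'a :: bezout_domain mat"
  assumes T: "T \<in> carrier_mat 2 2" and TT: "T * T = 0\<^sub>m 2 2"
  shows "unit_interpolated (ring_mat TYPE('a) 2 e) T"
proof (rule unit_interpolated_if_minors_zero[OF _ T])
  have sq: "T $$ (i, 0) * T $$ (0, j) + T $$ (i, 1) * T $$ (1, j) = 0" if "i < 2" "j < 2" for i j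
    using index_mult_mat_2[OF T T that] that by (simp add: TT)
  note e = sq[of 0 0, simplified] sq[of 0 1, simplified] sq[of 1 0, simplified]
    sq[of 1 1, simplified]
  have det: "T $$ (0, 0) * T $$ (1, 1) = T $$ (0, 1) * T $$ (1, 0)"
    by (rule square_zero_minors(1)[where x = 0 and y = 0]) (use e in \<open>simp_all add: algebra_simps\<close>)
  fix i j k l :: nat
  assume "i < 2" "j < 2" "k < 2" "l < 2"
  then show "T $$ (i, j) * T $$ (k, l) = T $$ (i, l) * T $$ (k, j)"
    using det by (auto simp: less_2_cases_iff mult.commute)
qed simp

lemma unit_interpolated_first_row_zero_3:
  fixes T :: "'a :: bezout_domain mat"
  assumes T: "T \<in> carrier_mat 3 3" and TT: "T * T = 0\<^sub>m 3 3"
    and row0: "\<And>j. j < 3 \<Longrightarrow> T $$ (0, j) = 0"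
  shows "unit_interpolated (ring_mat TYPE('a) 3 e) T"
proof (rule unit_interpolated_if_minors_zero[OF _ T])
  \<comment> \<open>The zero row 0 removes the middle index 0 from every entry of
    \<open>T * T\<close>.\<close>
  have sq: "T $$ (i, 1) * T $$ (1, j) + T $$ (i, 2) * T $$ (2, j) = 0" if "i < 3" "j < 3" for i j
    using index_mult_mat_3[OF T T that] that row0 by (simp add: TT)
  have pre: "T $$ (1, 1) * T $$ (1, 1) + T $$ (1, 2) * T $$ (2, 1) = 0"
    "T $$ (1, 2) * (T $$ (1, 1) + T $$ (2, 2)) = 0"
    "T $$ (2, 1) * (T $$ (1, 1) + T $$ (2, 2)) = 0"
    "T $$ (2, 2) * T $$ (2, 2) + T $$ (1, 2) * T $$ (2, 1) = 0"
    "T $$ (1, 1) * T $$ (1, 0) + T $$ (1, 2) * T $$ (2, 0) = 0"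
    "T $$ (2, 1) * T $$ (1, 0) + T $$ (2, 2) * T $$ (2, 0) = 0"
    using sq[of 1 0] sq[of 1 1] sq[of 1 2] sq[of 2 0] sq[of 2 1] sq[of 2 2]
    by (simp_all add: algebra_simps)
  \<comment> \<open>These are the three minors of rows 1 and 2, with column 0 in the role of
    \<open>(x, y)\<close>. Minors involving row 0 vanish, and those with a repeated row or column
    are trivial.\<close>
  note m = square_zero_minors[OF pre]
  have less3: "x < 3 \<longleftrightarrow> x = 0 \<or> x = 1 \<or> x = 2" for x :: nat by auto
  fix i j k l :: nat
  assume "i < 3" "j < 3" "k < 3" "l < 3"
  then show "T $$ (i, j) * T $$ (k, l) = T $$ (i, l) * T $$ (k, j)"
    using m row0 unfolding less3 by (elim disjE) (simp_all add: mult.commute)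
qed simp

text \<open>If \<open>Q\<close> reduces a nonzero row of \<open>T\<close> to its first entry
  \<open>r\<close>, then that row of \<open>T * Q * ?T' = T * T * Q = 0\<close> says that
  \<open>r\<close> times row 0 of the conjugate \<open>?T'\<close> is zero.\<close>

lemma unit_interpolated_square_zero_3:
  fixes T :: "'a :: bezout_domain mat"
  assumes T: "T \<in> carrier_mat 3 3" and TT: "T * T = 0\<^sub>m 3 3"
  shows "unit_interpolated (ring_mat TYPE('a) 3 e) T"
proof (cases "\<exists>i < 3. \<exists>j < 3. T $$ (i, j) \<noteq> 0")
  case False
  then show ?thesis using T TT by (intro unit_interpolated_first_row_zero_3) auto
next
  case True
  let ?S = "ring_mat TYPE('a) 3 e"
  interpret ring ?S by (rule ring_mat)
  from True obtain i j where ij: "i < 3" "j < 3" and nz: "T $$ (i, j) \<noteq> 0" by blast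
  obtain Q where Q: "Q \<in> Units ?S" and Qi: "\<forall>l < 3. l \<noteq> 0 \<longrightarrow> row T i \<bullet> col Q l = 0"
    using bezout_row_reduction[of 3 "row T i" e] row_carrier_vec[OF ij(1) T] by auto
  have Qc: "Q \<in> carrier_mat 3 3" using Q by (rule Units_ring_mat_carrier)
  \<comment> \<open>Here \<open>P\<close> has to be the inverse of \<open>Q\<close>: a conjugate of
    \<open>T\<close> still squares to zero, unlike a general equivalent matrix.\<close>
  define P where "P = inv\<^bsub>?S\<^esub> Q"
  have P: "P \<in> Units ?S" unfolding P_def using Q by simp
  have Pc: "P \<in> carrier_mat 3 3" using P by (rule Units_ring_mat_carrier)
  have QP: "Q * P = 1\<^sub>m 3" using Units_r_inv[OF Q] by (simp add: P_def ring_mat_simps)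
  let ?T' = "P * T * Q"
  have c: "?T' \<in> carrier_mat 3 3" using Pc T Qc by simp
  have TQT: "T * Q * ?T' = 0\<^sub>m 3 3"
  proof -
    have "T * Q * ?T' = T * (Q * P) * T * Q"
      using T Qc Pc by (simp add: assoc_mult_mat[of _ 3 3 _ 3 _ 3])
    then show ?thesis using T Qc TT by (simp add: QP)
  qed
  have "?T' * ?T' = P * (T * Q * ?T')"
    using T Qc Pc by (simp add: assoc_mult_mat[of _ 3 3 _ 3 _ 3])
  then have sq: "?T' * ?T' = 0\<^sub>m 3 3" using Pc by (simp add: TQT)
  have TQi: "(T * Q) $$ (i, l) = 0" if "l < 3" "l \<noteq> 0" for l
    using that Qi T Qc ij by simp
  \<comment> \<open>Otherwise row \<open>i\<close> of \<open>T * Q\<close> would vanish, and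
    multiplying back by \<open>P\<close> would make row \<open>i\<close> of \<open>T\<close>
    zero.\<close>
  have d: "(T * Q) $$ (i, 0) \<noteq> 0"
  proof
    assume "(T * Q) $$ (i, 0) = 0"
    with TQi have z: "(T * Q) $$ (i, l) = 0" if "l < 3" for l using that by (cases "l = 0") auto
    have "T = T * Q * P" using T Qc Pc by (simp add: assoc_mult_mat[of _ 3 3 _ 3 _ 3] QP)
    then have "T $$ (i, j) = (T * Q * P) $$ (i, j)" by simp
    also have "\<dots> = 0"
      using index_mult_mat_3[of "T * Q" P i j] T Qc Pc ij z by simp
    finally show False using nz by simp
  qed
  have "?T' $$ (0, l) = 0" if l: "l < 3" for l
  proof -
    \<comment> \<open>Row \<open>i\<close> of \<open>T * Q\<close> is supported in column 0, so only
      row 0 of \<open>?T'\<close> contributes.\<close>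
    have "(T * Q) $$ (i, 0) * ?T' $$ (0, l) = (T * Q * ?T') $$ (i, l)"
      using index_mult_mat_3[of "T * Q" ?T' i l] T Qc c ij l TQi[of 1] TQi[of 2] by simp
    also have "\<dots> = 0" using TQT ij l by simp
    finally show ?thesis using d by simp
  qed
  then have "unit_interpolated ?S ?T'"
    by (intro unit_interpolated_first_row_zero_3 c sq)
  then show ?thesis
    using P Q T
    by (intro unit_interpolated_if_equivalent[of T P Q]) (simp_all add: ring_mat_simps)
qed

theorem mainTheorem3:
  fixes T :: "'a::bezout_domain mat" and n :: nat
  assumes "n \<in> {2, 3}"
    and "T \<in> carrier_mat n n"
    and "T ^\<^sub>m 2 = 0\<^sub>m n n"
  shows "left_stable_range_one (ring_mat TYPE('a) n ()) T"
proof -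
  interpret ring "ring_mat TYPE('a) n ()" by (rule ring_mat)
  have "T * T = 0\<^sub>m n n" using assms by (simp add: numeral_2_eq_2)
  then have "unit_interpolated (ring_mat TYPE('a) n ()) T"
    using assms unit_interpolated_square_zero_2 unit_interpolated_square_zero_3 by auto
  then show ?thesis
    using assms by (intro left_stable_range_one_if_unit_interpolated) (simp_all add: ring_mat_simps)
qed

end
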